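(* Assume $A_n$ satisfies (C1), the mean field condition $\lim_{n\to\infty}\frac1n\sum_{i,j=1}^nA_n(i,j)^2=0$, and the asymptotic regularity condition $$\lim_{n\to\infty}\frac1n\sum_{i=1}^n\big(\mathcal R_n(i)-\overline{\mathcal R}_n\big)^2=0.$$ Then for every $(\beta,B)\in\Theta$, $T_n(\mathbf X)\to0$ in $\mathbb P_{n,\beta,B}$-probability.
   Context: For each $n$, $A_n$ is a known symmetric $n\times n$ matrix with non-negative entries and zero diagonal. The Ising model is $\mathbb P_{n,\beta,B}(\mathbf X=\mathbf x)=Z_n(\beta,B)^{-1}\exp(\frac{\beta}{2}\mathbf x^\top A_n\mathbf x+B\sum_i x_i)$ on $\{-1,1\}^n$. (C1): there is a constant $\gamma<\infty$ with $\max_{i}\sum_{j}A_n(i,j)\le\gamma$ for all $n$. $\Theta=\{(\beta,B):\beta>0,B\ne0\}$. $\mathcal R_n(i)=\sum_{j}A_n(i,j)$, $\overline{\mathcal R}_n=\frac1n\sum_i\mathcal R_n(i)$. $m_i(\mathbf x)=\sum_jA_n(i,j)x_j$, $\bar m(\mathbf x)=\frac1n\sum_i m_i(\mathbf x)$, $T_n(\mathbf x)=\frac1n\sum_i(m_i(\mathbf x)-\bar m(\mathbf x))^2$. *)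

theory Defs
  imports "HOL-Analysis.Analysis"
begin

text \<open>A sequence of matrices is given as A :: nat => nat => nat => real, where
  A n i j is the (i,j) entry of the n x n matrix A_n, indices i,j in {0..<n}.
  Spin configurations are functions x : {0..<n} -> {-1,1} (extensional).\<close>

definition spins :: "nat \<Rightarrow> (nat \<Rightarrow> real) set" where
  "spins n = PiE {0..<n} (\<lambda>_. {-1, 1})"

definition ising_weight :: "(nat \<Rightarrow> nat \<Rightarrow> real) \<Rightarrow> nat \<Rightarrow> real \<Rightarrow> real \<Rightarrow> (nat \<Rightarrow> real) \<Rightarrow> real" where
  "ising_weight M n \<beta> B x =
     exp (\<beta> / 2 * (\<Sum>i<n. \<Sum>j<n. x i * M i j * x j) + B * (\<Sum>i<n. x i))"

definition ising_Z :: "(nat \<Rightarrow> nat \<Rightarrow> real) \<Rightarrow> nat \<Rightarrow> real \<Rightarrow> real \<Rightarrow> real" where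
  "ising_Z M n \<beta> B = (\<Sum>x\<in>spins n. ising_weight M n \<beta> B x)"

definition ising_prob :: "(nat \<Rightarrow> nat \<Rightarrow> real) \<Rightarrow> nat \<Rightarrow> real \<Rightarrow> real \<Rightarrow> ((nat \<Rightarrow> real) \<Rightarrow> bool) \<Rightarrow> real" where
  "ising_prob M n \<beta> B E =
     (\<Sum>x\<in>{x\<in>spins n. E x}. ising_weight M n \<beta> B x) / ising_Z M n \<beta> B"

definition row_sum :: "(nat \<Rightarrow> nat \<Rightarrow> real) \<Rightarrow> nat \<Rightarrow> nat \<Rightarrow> real" where
  "row_sum M n i = (\<Sum>j<n. M i j)"

definition avg_row_sum :: "(nat \<Rightarrow> nat \<Rightarrow> real) \<Rightarrow> nat \<Rightarrow> real" where
  "avg_row_sum M n = (1 / real n) * (\<Sum>i<n. row_sum M n i)"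

definition local_field :: "(nat \<Rightarrow> nat \<Rightarrow> real) \<Rightarrow> nat \<Rightarrow> (nat \<Rightarrow> real) \<Rightarrow> nat \<Rightarrow> real" where
  "local_field M n x i = (\<Sum>j<n. M i j * x j)"

definition avg_local_field :: "(nat \<Rightarrow> nat \<Rightarrow> real) \<Rightarrow> nat \<Rightarrow> (nat \<Rightarrow> real) \<Rightarrow> real" where
  "avg_local_field M n x = (1 / real n) * (\<Sum>i<n. local_field M n x i)"

definition T_stat :: "(nat \<Rightarrow> nat \<Rightarrow> real) \<Rightarrow> nat \<Rightarrow> (nat \<Rightarrow> real) \<Rightarrow> real" where
  "T_stat M n x = (1 / real n) * (\<Sum>i<n. (local_field M n x i - avg_local_field M n x)\<^sup>2)"

end

(* For B > 0 the FKG inequality makes all spin covariances non-negative and expectations of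
   increasing functions monotone in the field.  The total magnetisation lies in [-n, n] and its
   derivative in the field is the sum of the spin covariances, so arbitrarily close to B, on either
   side, there are fields at which this sum is O(n).  At such a field the mean field condition and
   Cauchy-Schwarz give a total variance o(n) of the local fields m_i, so their means u_i nearly solve
   u = A tanh(beta u + B), and u_i >= 0 by FKG.  On [0, oo) the map t -> r tanh(beta t + B), with r
   the average row sum, contracts towards its unique fixed point by concavity; asymptotic regularity
   then forces u_i to be close to that fixed point on average.  Finally E m_i and E (m_i + gamma)^2
   are monotone in the field, so the conclusion is squeezed from the nearby fields to B itself.
   The case B < 0 follows by flipping all spins. *)

theory Submission
  imports Defs
begin

section \<open>Spin configurations and sums over them\<close>

lemma finite_spins [simp]: "finite (spins n)"
  unfolding spins_def by (intro finite_PiE) auto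

lemma spinsD: "x \<in> spins n \<Longrightarrow> i < n \<Longrightarrow> x i = -1 \<or> x i = 1"
  unfolding spins_def by (auto dest!: PiE_mem[where x = i])

lemma spins_abs: "x \<in> spins n \<Longrightarrow> i < n \<Longrightarrow> \<bar>x i\<bar> = 1"
  using spinsD[of x n i] by auto

lemma spins_nonempty [simp]: "spins n \<noteq> {}"
  unfolding spins_def by (simp add: PiE_eq_empty_iff)

lemma spins_upd: "x \<in> spins n \<Longrightarrow> i < n \<Longrightarrow> a \<in> {-1, 1} \<Longrightarrow> x(i := a) \<in> spins n"
  unfolding spins_def by (auto simp: PiE_iff extensional_def)

text \<open>Peels off the last site for the induction in \<open>FKG\<close>. Extensionality of the
  elements of \<open>spins n\<close> makes \<open>(a, x) \<mapsto> x(n := a)\<close>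
  injective.\<close>

lemma sum_spins_Suc:
  "(\<Sum>x\<in>spins (Suc n). F x) = (\<Sum>x\<in>spins n. F (x(n := 1)) + F (x(n := -1)))"
proof -
  have eq: "spins (Suc n) = (\<lambda>(a, x). x(n := a)) ` ({-1, 1} \<times> spins n)"
    unfolding spins_def atLeast0_lessThan_Suc by (simp add: PiE_insert_eq)
  have inj: "inj_on (\<lambda>(a, x). x(n := a)) ({-1, 1::real} \<times> spins n)"
    unfolding spins_def using inj_combinator[of n "{0..<n}" "\<lambda>_. {-1, 1::real}"] by simp
  have "(\<Sum>x\<in>spins (Suc n). F x) = (\<Sum>(a, x)\<in>{-1, 1} \<times> spins n. F (x(n := a)))"
    unfolding eq by (subst sum.reindex[OF inj]) (simp add: case_prod_unfold)
  also have "\<dots> = (\<Sum>a\<in>{-1, 1}. \<Sum>x\<in>spins n. F (x(n := a)))"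
    by (simp add: sum.cartesian_product)
  finally show ?thesis by (simp add: sum.distrib add.commute)
qed

section \<open>The FKG inequality for pair interactions with site-dependent fields\<close>

definition site_weight :: "(nat \<Rightarrow> nat \<Rightarrow> real) \<Rightarrow> nat \<Rightarrow> (nat \<Rightarrow> real) \<Rightarrow> (nat \<Rightarrow> real) \<Rightarrow> real" where
  "site_weight J n h x = exp ((\<Sum>i<n. \<Sum>j<n. x i * J i j * x j) + (\<Sum>i<n. h i * x i))"

lemma site_weight_pos: "0 < site_weight J n h x"
  by (simp add: site_weight_def)

text \<open>With the last spin frozen at \<open>a\<close>, its couplings act on the other sites as
  an extra field. The factor 2 arises because the double sum counts each pair in both
  orders.\<close>

lemma site_weight_Suc:
  assumes "\<And>i. i < n \<Longrightarrow> J i n = J n i"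
  shows "site_weight J (Suc n) h (x(n := a)) =
    exp (J n n * a\<^sup>2 + h n * a) * site_weight J n (\<lambda>i. h i + 2 * a * J i n) x"
proof -
  let ?y = "x(n := a)"
  have "(\<Sum>i<Suc n. \<Sum>j<Suc n. ?y i * J i j * ?y j) =
      (\<Sum>i<n. (\<Sum>j<n. x i * J i j * x j) + x i * J i n * a) + (\<Sum>j<n. a * J n j * x j) + J n n * a\<^sup>2"
    by (simp add: power2_eq_square)
  also have "\<dots> = (\<Sum>i<n. \<Sum>j<n. x i * J i j * x j) + (\<Sum>i<n. 2 * a * J i n * x i) + J n n * a\<^sup>2"
  proof -
    have "(\<Sum>i<n. x i * J i n * a) + (\<Sum>j<n. a * J n j * x j) = (\<Sum>i<n. 2 * a * J i n * x i)"
      unfolding sum.distrib[symmetric] by (rule sum.cong) (auto simp: assms algebra_simps)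
    then show ?thesis by (simp add: sum.distrib)
  qed
  finally have q: "(\<Sum>i<Suc n. \<Sum>j<Suc n. ?y i * J i j * ?y j) = \<dots>" .
  have l: "(\<Sum>i<Suc n. h i * ?y i) = (\<Sum>i<n. h i * x i) + h n * a"
    by simp
  show ?thesis
    unfolding site_weight_def q l exp_add[symmetric]
    by (simp add: sum.distrib algebra_simps)
qed

lemma mono_updI: "mono f \<Longrightarrow> mono (\<lambda>x. f (x(n := (a::real))))"
  by (rule monoI, erule monoD) (simp add: le_fun_def)

text \<open>Chebyshev's association inequality for a two-point measure with masses \<open>Z\<close>
  and \<open>Z'\<close>: \<open>F / Z\<close> and \<open>F' / Z'\<close> are the conditional means
  of one function, likewise for \<open>G\<close>. The two conditional means are ordered the same way
  for both functions, so the cross term \<open>Z * Z' * ((a - a') * (b - b'))\<close> is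
  non-negative.\<close>

lemma two_point_chebyshev:
  fixes Z Z' F F' G G' H H' :: real
  assumes Z: "0 < Z" "0 < Z'" and H: "F * G \<le> Z * H" "F' * G' \<le> Z' * H'"
    and F: "F' * Z \<le> Z' * F" and G: "G' * Z \<le> Z' * G"
  shows "(F + F') * (G + G') \<le> (Z + Z') * (H + H')"
proof -
  define a a' b b' where "a = F / Z" and "a' = F' / Z'" and "b = G / Z" and "b' = G' / Z'"
  have e: "F = Z * a" "F' = Z' * a'" "G = Z * b" "G' = Z' * b'"
    using Z by (simp_all add: a_def a'_def b_def b'_def)
  have ab: "a' \<le> a" "b' \<le> b"
    using F G Z by (simp_all add: a_def a'_def b_def b'_def field_simps)
  have h: "Z * (a * b) \<le> H" "Z' * (a' * b') \<le> H'"
    using H Z unfolding e by (simp_all add: mult.assoc mult.left_commute[of a] mult.left_commute[of a'])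
  have "(Z + Z') * (H + H') \<ge> (Z + Z') * (Z * (a * b) + Z' * (a' * b'))"
    using h Z by (intro mult_left_mono) auto
  moreover have "(Z + Z') * (Z * (a * b) + Z' * (a' * b')) - (F + F') * (G + G') =
      Z * Z' * ((a - a') * (b - b'))"
    unfolding e by (simp add: algebra_simps)
  moreover have "0 \<le> Z * Z' * ((a - a') * (b - b'))"
    using Z ab by simp
  ultimately show ?thesis by linarith
qed

text \<open>Induction on the number of sites: fixing the last spin leaves a model of the same
  kind with shifted fields, which is why the fields are allowed to vary from site to site.\<close>

theorem FKG:
  assumes "\<And>i j. i < n \<Longrightarrow> j < n \<Longrightarrow> J i j = J j i"
    and "\<And>i j. i < n \<Longrightarrow> j < n \<Longrightarrow> 0 \<le> J i j"
    and "mono f" and "mono g"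
  shows "(\<Sum>x\<in>spins n. site_weight J n h x * f x) * (\<Sum>x\<in>spins n. site_weight J n h x * g x)
    \<le> (\<Sum>x\<in>spins n. site_weight J n h x) * (\<Sum>x\<in>spins n. site_weight J n h x * (f x * g x))"
  using assms
proof (induction n arbitrary: h f g)
  case 0
  then show ?case by (simp add: spins_def algebra_simps)
next
  case (Suc n)
  define c where "c a = exp (J n n * a\<^sup>2 + h n * a)" for a
  define w where "w a = site_weight J n (\<lambda>i. h i + 2 * a * J i n)" for a
  \<comment> \<open>\<open>S a F\<close> is the part of the weighted sum of \<open>F\<close> in
    which the last spin equals \<open>a\<close>.\<close>
  define S where "S a F = c a * (\<Sum>x\<in>spins n. w a x * F (x(n := a)))" for a and F :: "(nat \<Rightarrow> real) \<Rightarrow> real"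
  have c: "c a > 0" for a by (simp add: c_def)
  have split: "(\<Sum>x\<in>spins (Suc n). site_weight J (Suc n) h x * F x) = S 1 F + S (-1) F" for F
    using Suc.prems(1) unfolding sum_spins_Suc
    by (simp add: site_weight_Suc S_def c_def w_def sum.distrib sum_distrib_left mult.assoc)
  have IH: "(\<Sum>x\<in>spins n. w a x * F x) * (\<Sum>x\<in>spins n. w a x * G x)
    \<le> (\<Sum>x\<in>spins n. w a x) * (\<Sum>x\<in>spins n. w a x * (F x * G x))" if "mono F" "mono G" for a F G
    unfolding w_def by (rule Suc.IH) (use Suc.prems that in auto)
  have prod: "S a f * S a g \<le> S a (\<lambda>_. 1) * S a (\<lambda>x. f x * g x)" for a
  proof -
    have "c a * c a * ((\<Sum>x\<in>spins n. w a x * f (x(n := a))) * (\<Sum>x\<in>spins n. w a x * g (x(n := a))))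
      \<le> c a * c a * ((\<Sum>x\<in>spins n. w a x) * (\<Sum>x\<in>spins n. w a x * (f (x(n := a)) * g (x(n := a)))))"
      using c[of a] by (intro mult_left_mono IH[OF mono_updI mono_updI] Suc.prems) auto
    then show ?thesis by (simp add: S_def mult_ac)
  qed
  have pos: "S a (\<lambda>_. 1) > 0" for a
    unfolding S_def w_def using c by (auto intro!: mult_pos_pos sum_pos site_weight_pos)
  \<comment> \<open>The conditional mean of \<open>F\<close> increases when the last spin goes from
    -1 to 1. The change of weight is a tilt by an increasing function, handled by the induction
    hypothesis; the change of the last argument of \<open>F\<close> is handled by
    monotonicity.\<close>
  have cmp: "S (-1) F * S 1 (\<lambda>_. 1) \<le> S 1 F * S (-1) (\<lambda>_. 1)" if F: "mono F" for F
  proof -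
    \<comment> \<open>Ratio of the two conditional weights: the fields differ by
      \<open>4 * J i n\<close>, and non-negative couplings make it increasing.\<close>
    define e where "e x = exp (4 * (\<Sum>i<n. J i n * x i))" for x
    have e: "w 1 x = w (-1) x * e x" for x
    proof -
      have "4 * (\<Sum>i<n. J i n * x i) = (\<Sum>i<n. 2 * J i n * x i) - (\<Sum>i<n. - 2 * J i n * x i)"
        unfolding sum_distrib_left sum_subtractf[symmetric] by (rule sum.cong) auto
      then show ?thesis
        unfolding w_def site_weight_def e_def exp_add[symmetric]
        by (simp add: sum.distrib sum_subtractf sum_negf algebra_simps)
    qed
    have "mono e"
      unfolding e_def using Suc.prems(2)
      by (intro monoI) (auto intro!: sum_mono mult_left_mono simp: le_fun_def)
    from IH[OF mono_updI[OF F, of n "-1"] this, of "-1"]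
    have "(\<Sum>x\<in>spins n. w (-1) x * F (x(n := -1))) * (\<Sum>x\<in>spins n. w 1 x)
      \<le> (\<Sum>x\<in>spins n. w (-1) x) * (\<Sum>x\<in>spins n. w 1 x * F (x(n := -1)))"
      by (simp add: e mult_ac)
    also have "\<dots> \<le> (\<Sum>x\<in>spins n. w (-1) x) * (\<Sum>x\<in>spins n. w 1 x * F (x(n := 1)))"
      unfolding w_def
      by (intro mult_left_mono sum_mono sum_nonneg monoD[OF F] less_imp_le[OF site_weight_pos])
        (auto simp: le_fun_def)
    finally have "c 1 * c (-1) * ((\<Sum>x\<in>spins n. w (-1) x * F (x(n := -1))) * (\<Sum>x\<in>spins n. w 1 x))
      \<le> c 1 * c (-1) * ((\<Sum>x\<in>spins n. w (-1) x) * (\<Sum>x\<in>spins n. w 1 x * F (x(n := 1))))"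
      using c[of 1] c[of "-1"] by (intro mult_left_mono) auto
    then show ?thesis by (simp add: S_def mult_ac)
  qed
  have "(S 1 f + S (-1) f) * (S 1 g + S (-1) g)
      \<le> (S 1 (\<lambda>_. 1) + S (-1) (\<lambda>_. 1)) * (S 1 (\<lambda>x. f x * g x) + S (-1) (\<lambda>x. f x * g x))"
    using cmp[OF Suc.prems(3)] cmp[OF Suc.prems(4)]
    by (intro two_point_chebyshev pos prod) (simp_all add: mult_ac)
  then show ?case
    using split[of "\<lambda>_. 1"] by (simp add: split)
qed

section \<open>Expectations under the Ising measure\<close>

definition ising_expect ::
    "(nat \<Rightarrow> nat \<Rightarrow> real) \<Rightarrow> nat \<Rightarrow> real \<Rightarrow> real \<Rightarrow> ((nat \<Rightarrow> real) \<Rightarrow> real) \<Rightarrow> real" where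
  "ising_expect M n \<beta> B f = (\<Sum>x\<in>spins n. ising_weight M n \<beta> B x * f x) / ising_Z M n \<beta> B"

lemma ising_weight_pos: "0 < ising_weight M n \<beta> B x"
  by (simp add: ising_weight_def)

lemma ising_Z_pos: "0 < ising_Z M n \<beta> B"
  unfolding ising_Z_def by (intro sum_pos ising_weight_pos) auto

lemma expect_const [simp]: "ising_expect M n \<beta> B (\<lambda>_. c) = c"
  using ising_Z_pos[of M n \<beta> B]
  by (simp add: ising_expect_def ising_Z_def flip: sum_distrib_right)

lemma expect_add:
  "ising_expect M n \<beta> B (\<lambda>x. f x + g x) = ising_expect M n \<beta> B f + ising_expect M n \<beta> B g"
  by (simp add: ising_expect_def distrib_left sum.distrib add_divide_distrib)

lemma expect_diff:
  "ising_expect M n \<beta> B (\<lambda>x. f x - g x) = ising_expect M n \<beta> B f - ising_expect M n \<beta> B g"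
  by (simp add: ising_expect_def right_diff_distrib sum_subtractf diff_divide_distrib)

lemma expect_cmult: "ising_expect M n \<beta> B (\<lambda>x. c * f x) = c * ising_expect M n \<beta> B f"
  by (simp add: ising_expect_def sum_distrib_left mult_ac)

lemma expect_sum:
  "ising_expect M n \<beta> B (\<lambda>x. \<Sum>i\<in>I. f i x) = (\<Sum>i\<in>I. ising_expect M n \<beta> B (f i))"
  unfolding ising_expect_def sum_distrib_left sum_divide_distrib by (rule sum.swap)

lemma expect_mono:
  "(\<And>x. x \<in> spins n \<Longrightarrow> f x \<le> g x) \<Longrightarrow> ising_expect M n \<beta> B f \<le> ising_expect M n \<beta> B g"
  unfolding ising_expect_def
  by (intro divide_right_mono sum_mono mult_left_mono less_imp_le[OF ising_weight_pos]
      less_imp_le[OF ising_Z_pos]) auto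

lemma expect_cong:
  "(\<And>x. x \<in> spins n \<Longrightarrow> f x = g x) \<Longrightarrow> ising_expect M n \<beta> B f = ising_expect M n \<beta> B g"
  by (simp add: ising_expect_def)

lemma expect_nonneg: "(\<And>x. x \<in> spins n \<Longrightarrow> 0 \<le> f x) \<Longrightarrow> 0 \<le> ising_expect M n \<beta> B f"
  using expect_mono[of n "\<lambda>_. 0" f M \<beta> B] by simp

lemma expect_abs_le: "\<bar>ising_expect M n \<beta> B f\<bar> \<le> ising_expect M n \<beta> B (\<lambda>x. \<bar>f x\<bar>)"
proof -
  have "ising_expect M n \<beta> B (\<lambda>x. (-1) * f x) \<le> ising_expect M n \<beta> B (\<lambda>x. \<bar>f x\<bar>)"
    by (rule expect_mono) simp
  moreover have "ising_expect M n \<beta> B f \<le> ising_expect M n \<beta> B (\<lambda>x. \<bar>f x\<bar>)"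
    by (rule expect_mono) simp
  ultimately show ?thesis unfolding expect_cmult by simp
qed

lemma expect_centered_prod:
  fixes f g :: "(nat \<Rightarrow> real) \<Rightarrow> real" and M n \<beta> B
  defines "a \<equiv> ising_expect M n \<beta> B f" and "b \<equiv> ising_expect M n \<beta> B g"
  shows "ising_expect M n \<beta> B (\<lambda>x. (f x - a) * (g x - b)) = ising_expect M n \<beta> B (\<lambda>x. f x * g x) - a * b"
proof -
  have "ising_expect M n \<beta> B (\<lambda>x. (f x - a) * (g x - b)) =
      ising_expect M n \<beta> B (\<lambda>x. f x * g x - a * g x - b * f x + a * b)"
    by (rule expect_cong) (simp add: algebra_simps)
  then show ?thesis
    by (simp add: expect_add expect_diff expect_cmult flip: a_def b_def)
qed

text \<open>The variance is non-negative.\<close>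

lemma expect_power2_le:
  "(ising_expect M n \<beta> B f)\<^sup>2 \<le> ising_expect M n \<beta> B (\<lambda>x. (f x)\<^sup>2)"
  using expect_centered_prod[of M n \<beta> B f f]
    expect_nonneg[of n "\<lambda>x. (f x - ising_expect M n \<beta> B f) * (f x - ising_expect M n \<beta> B f)" M \<beta> B]
  by (simp add: power2_eq_square)

lemma ising_prob_eq: "ising_prob M n \<beta> B P = ising_expect M n \<beta> B (\<lambda>x. if P x then 1 else 0)"
  unfolding ising_prob_def ising_expect_def by (simp add: sum.inter_filter if_distrib cong: if_cong)

lemma ising_prob_nonneg: "0 \<le> ising_prob M n \<beta> B P"
  unfolding ising_prob_eq by (rule expect_nonneg) simp

lemma ising_prob_markov:
  assumes "0 < \<epsilon>" and "\<And>x. x \<in> spins n \<Longrightarrow> 0 \<le> f x"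
  shows "ising_prob M n \<beta> B (\<lambda>x. \<epsilon> < f x) \<le> ising_expect M n \<beta> B f / \<epsilon>"
proof -
  have "ising_prob M n \<beta> B (\<lambda>x. \<epsilon> < f x) \<le> ising_expect M n \<beta> B (\<lambda>x. (1 / \<epsilon>) * f x)"
    unfolding ising_prob_eq using assms by (intro expect_mono) (auto simp: field_simps)
  then show ?thesis by (simp only: expect_cmult) simp
qed

section \<open>The global spin flip\<close>

text \<open>The restriction keeps the flipped configuration extensional, so that the flip is an
  involution of \<open>spins n\<close>.\<close>

definition flip_all :: "nat \<Rightarrow> (nat \<Rightarrow> real) \<Rightarrow> nat \<Rightarrow> real" where
  "flip_all n x = restrict (\<lambda>i. - x i) {0..<n}"

lemma flip_all_apply [simp]: "i < n \<Longrightarrow> flip_all n x i = - x i"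
  by (simp add: flip_all_def)

lemma flip_all_spins: "x \<in> spins n \<Longrightarrow> flip_all n x \<in> spins n"
  unfolding spins_def flip_all_def by (auto simp: PiE_iff)

lemma flip_all_flip_all: "x \<in> spins n \<Longrightarrow> flip_all n (flip_all n x) = x"
  unfolding spins_def flip_all_def by (auto simp: PiE_iff extensional_def)

lemma sum_spins_flip_all: "(\<Sum>x\<in>spins n. F x) = (\<Sum>x\<in>spins n. F (flip_all n x))"
  by (rule sum.reindex_bij_witness[where i = "flip_all n" and j = "flip_all n"])
    (auto simp: flip_all_spins flip_all_flip_all)

text \<open>The quadratic form is even in the spins and the total spin is odd, so only the sign of
  the field changes.\<close>

lemma ising_weight_flip_all: "ising_weight M n \<beta> B (flip_all n x) = ising_weight M n \<beta> (- B) x"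
  unfolding ising_weight_def by (simp add: sum_negf)

lemma expect_flip_all:
  "ising_expect M n \<beta> (- B) f = ising_expect M n \<beta> B (\<lambda>x. f (flip_all n x))"
proof -
  have Z: "ising_Z M n \<beta> (- B) = ising_Z M n \<beta> B"
    unfolding ising_Z_def by (subst sum_spins_flip_all) (simp add: ising_weight_flip_all)
  show ?thesis
    unfolding ising_expect_def Z by (subst sum_spins_flip_all) (simp add: ising_weight_flip_all)
qed

section \<open>Dependence on the field, and the single-spin identity\<close>

text \<open>Changing the field tilts the measure by an exponential of the total spin, so
  monotonicity in the field becomes a correlation inequality at one fixed field.\<close>

lemma expect_change_field:
  fixes M \<beta> and n :: nat and B B' :: real
  defines "e \<equiv> \<lambda>x. exp ((B' - B) * (\<Sum>i<n. x i :: real))"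
  shows "ising_expect M n \<beta> B' f = ising_expect M n \<beta> B (\<lambda>x. f x * e x) / ising_expect M n \<beta> B e"
proof -
  have w: "ising_weight M n \<beta> B' x = ising_weight M n \<beta> B x * e x" for x
    unfolding ising_weight_def e_def exp_add[symmetric] by (simp add: algebra_simps)
  show ?thesis
    using ising_Z_pos[of M n \<beta> B]
    by (simp add: ising_expect_def ising_Z_def[of M n \<beta> B'] w mult_ac)
qed

text \<open>Quotient rule: each field derivative of a weight brings down the total spin, which
  leaves the covariance of \<open>f\<close> with the total spin.\<close>

lemma expect_has_field_derivative:
  "((\<lambda>B. ising_expect M n \<beta> B f) has_real_derivative
      ising_expect M n \<beta> B (\<lambda>x. f x * (\<Sum>i<n. x i))
      - ising_expect M n \<beta> B f * ising_expect M n \<beta> B (\<lambda>x. \<Sum>i<n. x i)) (at B)"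
proof -
  have N: "((\<lambda>B. \<Sum>x\<in>spins n. ising_weight M n \<beta> B x * g x) has_real_derivative
      (\<Sum>x\<in>spins n. ising_weight M n \<beta> B x * (g x * (\<Sum>i<n. x i)))) (at B)" for g
    unfolding ising_weight_def
    by (rule derivative_eq_intros refl)+ (auto intro!: sum.cong simp: mult_ac)
  have Z: "((\<lambda>B. ising_Z M n \<beta> B) has_real_derivative
      (\<Sum>x\<in>spins n. ising_weight M n \<beta> B x * (\<Sum>i<n. x i))) (at B)"
    using N[of "\<lambda>_. 1"] by (simp add: ising_Z_def)
  show ?thesis
    unfolding ising_expect_def
    using ising_Z_pos[of M n \<beta> B]
    by (intro DERIV_cong[OF DERIV_divide[OF N Z]]) (simp_all add: field_simps)
qed

text \<open>Pairing a configuration with the one where spin i is reversed: the local field at i is the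
  same for both because the diagonal vanishes.\<close>

lemma expect_spin_eq_tanh:
  assumes symm: "\<And>i j. i < n \<Longrightarrow> j < n \<Longrightarrow> M i j = M j i" and diag: "M i i = 0" and i: "i < n"
  shows "ising_expect M n \<beta> B (\<lambda>x. x i) =
    ising_expect M n \<beta> B (\<lambda>x. tanh (\<beta> * local_field M n x i + B))"
proof -
  let ?w = "ising_weight M n \<beta> B" and ?r = "\<lambda>x. x(i := - x i :: real)"
  let ?\<theta> = "\<lambda>x. \<beta> * local_field M n x i + B"
  let ?F = "\<lambda>x. ?w x * (x i - tanh (?\<theta> x))"
  have r: "?r x \<in> spins n" if "x \<in> spins n" for x
    using spins_upd[OF that i, of "- x i"] spinsD[OF that i] by auto
  have "(\<Sum>x\<in>spins n. ?F x) = (\<Sum>x\<in>spins n. ?F (?r x))"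
    by (rule sum.reindex_bij_witness[where i = ?r and j = ?r]) (auto simp: r)
  then have 2: "2 * (\<Sum>x\<in>spins n. ?F x) = (\<Sum>x\<in>spins n. ?F x + ?F (?r x))"
    by (simp add: sum.distrib)
  have lf: "local_field M n (?r x) i = local_field M n x i" for x
    unfolding local_field_def using diag by (intro sum.cong) auto
  have "?F x + ?F (?r x) = 0" if x: "x \<in> spins n" for x
  proof -
    \<comment> \<open>The reference configuration has spin \<open>i\<close> set to 0, outside
      \<open>spins n\<close>. With zero diagonal the logarithm of the weight is affine in the value
      \<open>a\<close> of that spin, with slope \<open>?\<theta> x\<close>.\<close>
    define c where "c = ?w (x(i := 0))"
    have w: "?w (x(i := a)) = c * exp (a * ?\<theta> x)" for a
    proof -
      define y where "y = x(i := 0)"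
      have u: "x(i := a) = (\<lambda>j. y j + (if j = i then a else 0))"
        by (auto simp: y_def)
      have col: "(\<Sum>j<n. y j * M j i) = local_field M n x i"
        unfolding local_field_def using diag i by (intro sum.cong) (auto simp: symm y_def)
      have row: "(\<Sum>j<n. y j * M i j) = local_field M n x i"
        unfolding local_field_def using diag i by (intro sum.cong) (auto simp: y_def)
      have "(\<Sum>j<n. \<Sum>k<n. (y j + (if j = i then a else 0)) * M j k * (y k + (if k = i then a else 0)))
          = (\<Sum>j<n. \<Sum>k<n. y j * M j k * y k) + a * (\<Sum>j<n. y j * M j i)
            + a * (\<Sum>k<n. y k * M i k) + a * a * M i i"
      proof -
        have "(\<Sum>j<n. \<Sum>k<n. (y j + (if j = i then a else 0)) * M j k * (y k + (if k = i then a else 0)))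
          = (\<Sum>j<n. \<Sum>k<n. y j * M j k * y k + (if k = i then y j * M j k * a else 0)
             + (if j = i then a * M j k * y k else 0) + (if j = i then if k = i then a * a * M j k else 0 else 0))"
          by (intro sum.cong refl) (auto simp: algebra_simps)
        also have "\<dots> = (\<Sum>j<n. (\<Sum>k<n. y j * M j k * y k) + y j * M j i * a
             + (if j = i then (\<Sum>k<n. a * M j k * y k) else 0) + (if j = i then a * a * M j i else 0))"
          using i by (intro sum.cong refl) (auto simp: sum.distrib)
        also have "\<dots> = (\<Sum>j<n. \<Sum>k<n. y j * M j k * y k) + (\<Sum>j<n. y j * M j i * a)
            + (\<Sum>k<n. a * M i k * y k) + a * a * M i i"
          unfolding sum.distrib using i by simp
        finally show ?thesis by (simp add: sum_distrib_left mult_ac)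
      qed
      moreover have "(\<Sum>j<n. y j + (if j = i then a else 0)) = (\<Sum>j<n. y j) + a"
        unfolding sum.distrib using i by simp
      ultimately show ?thesis
        unfolding u c_def y_def[symmetric] ising_weight_def exp_add[symmetric]
        by (simp add: col row diag algebra_simps)
    qed
    \<comment> \<open>The mean of a single spin with weights \<open>exp t\<close> and
      \<open>exp (- t)\<close> is \<open>tanh t\<close>.\<close>
    have *: "exp t * (1 - tanh t) + exp (- t) * (- 1 - tanh t) = 0" for t :: real
    proof -
      have "tanh t * (exp t + exp (- t)) = exp t - exp (- t)"
        using add_pos_pos[OF exp_gt_zero[of t] exp_gt_zero[of "-t"]]
        by (simp add: tanh_altdef)
      then show ?thesis by (simp add: algebra_simps)
    qed
    have s: "?F x = c * exp (x i * ?\<theta> x) * (x i - tanh (?\<theta> x))"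
      using w[of "x i"] by simp
    have s': "?F (?r x) = c * exp (- x i * ?\<theta> x) * (- x i - tanh (?\<theta> x))"
      using w[of "- x i"] by (simp only: lf) simp
    from spinsD[OF x i] show ?thesis
    proof
      assume "x i = 1"
      then have "?F x + ?F (?r x) = c * (exp (?\<theta> x) * (1 - tanh (?\<theta> x)) + exp (- ?\<theta> x) * (- 1 - tanh (?\<theta> x)))"
        unfolding s s' by (simp add: algebra_simps)
      then show ?thesis unfolding * by simp
    next
      assume "x i = -1"
      then have "?F x + ?F (?r x) = c * (exp (?\<theta> x) * (1 - tanh (?\<theta> x)) + exp (- ?\<theta> x) * (- 1 - tanh (?\<theta> x)))"
        unfolding s s' by (simp add: algebra_simps)
      then show ?thesis unfolding * by simp
    qed
  qed
  with 2 have "(\<Sum>x\<in>spins n. ?F x) = 0" by simp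
  then have "ising_expect M n \<beta> B (\<lambda>x. x i - tanh (?\<theta> x)) = 0"
    by (simp add: ising_expect_def)
  then show ?thesis by (simp add: expect_diff)
qed

section \<open>The scalar mean field equation\<close>

text \<open>On the half-line the argument of \<open>tanh\<close> is non-negative, where the second
  derivative has the right sign. This is why non-negative mean local fields matter later.\<close>

lemma tanh_shift_concave:
  fixes \<beta> B :: real
  assumes "0 \<le> \<beta>" "0 \<le> B"
  shows "concave_on {0..} (\<lambda>u. tanh (\<beta> * u + B))"
proof (rule f''_le0_imp_concave)
  let ?f = "\<lambda>u. tanh (\<beta> * u + B)"
  have c: "cosh y \<noteq> 0" for y :: real by simp
  show "(?f has_real_derivative \<beta> * (1 - (?f u)\<^sup>2)) (at u)" for u
    by (rule derivative_eq_intros refl c | simp)+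
  show "((\<lambda>u. \<beta> * (1 - (?f u)\<^sup>2)) has_real_derivative
      - (2 * \<beta> * \<beta> * ?f u * (1 - (?f u)\<^sup>2))) (at u)" for u
    by (rule derivative_eq_intros refl c | simp)+
  show "- (2 * \<beta> * \<beta> * ?f u * (1 - (?f u)\<^sup>2)) \<le> 0" if "u \<in> {0..}" for u
  proof -
    have "(?f u)\<^sup>2 \<le> 1"
      using tanh_real_bounds[of "\<beta> * u + B"] by (auto simp: abs_square_le_1 abs_le_iff)
    moreover have "0 \<le> ?f u" using that assms by simp
    ultimately show ?thesis using assms by simp
  qed
qed simp

text \<open>By concavity the secant slope between \<open>u\<close> and \<open>t\<close> is at most
  the one between \<open>0\<close> and \<open>t\<close>, on either side of \<open>t\<close>.
  Multiplying by \<open>t\<close> avoids a division.\<close>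

lemma concave_chord_abs_le:
  fixes f :: "real \<Rightarrow> real"
  assumes f: "concave_on {0..} f" and mono: "mono f" and u: "0 \<le> u" and t: "0 \<le> t"
  shows "t * \<bar>f u - f t\<bar> \<le> (f t - f 0) * \<bar>u - t\<bar>"
proof (cases u t rule: linorder_cases)
  case less
  have "(1 - u / t) * f 0 + u / t * f t \<le> f ((1 - u / t) *\<^sub>R 0 + (u / t) *\<^sub>R t)"
    using less u by (intro concave_onD[OF f]) auto
  then have "t * ((1 - u / t) * f 0 + u / t * f t) \<le> t * f u"
    using less u by (intro mult_left_mono) auto
  moreover have "t * ((1 - u / t) * f 0 + u / t * f t) = (t - u) * f 0 + u * f t"
    using less u by (simp add: field_simps)
  ultimately have "(t - u) * f 0 + u * f t \<le> t * f u" by simp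
  then show ?thesis
    using monoD[OF mono, of u t] less by (simp add: algebra_simps)
next
  case greater
  have "(1 - t / u) * f 0 + t / u * f u \<le> f ((1 - t / u) *\<^sub>R 0 + (t / u) *\<^sub>R u)"
    using greater t by (intro concave_onD[OF f]) auto
  then have "u * ((1 - t / u) * f 0 + t / u * f u) \<le> u * f t"
    using greater t by (intro mult_left_mono) auto
  moreover have "u * ((1 - t / u) * f 0 + t / u * f u) = (u - t) * f 0 + t * f u"
    using greater t by (simp add: field_simps)
  ultimately have "(u - t) * f 0 + t * f u \<le> u * f t" by simp
  then show ?thesis
    using monoD[OF mono, of t u] greater by (simp add: algebra_simps)
qed simp

lemma tanh_lipschitz: "\<bar>tanh x - tanh y\<bar> \<le> \<bar>x - y :: real\<bar>"
proof -
  have *: "tanh b - tanh a \<le> b - a" if ab: "a < b" for a b :: real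
  proof -
    have der: "(tanh has_real_derivative 1 - tanh z ^ 2) (at z)" for z :: real
      unfolding tanh_def by (auto intro!: derivative_eq_intros simp: power2_eq_square field_split_simps)
    obtain z where "tanh b - tanh a = (b - a) * (1 - tanh z ^ 2)"
      using MVT2[OF ab der] by auto
    moreover have "(b - a) * (1 - tanh z ^ 2) \<le> (b - a) * 1"
      using ab by (intro mult_left_mono) auto
    ultimately show ?thesis by simp
  qed
  show ?thesis
    using *[of x y] *[of y x] by (cases x y rule: linorder_cases) auto
qed

text \<open>The intermediate value theorem gives \<open>t\<close>. The chord of the map from 0 to
  its fixed point has slope \<open>(t - r * tanh B) / t\<close>, which is at most
  \<open>1 - tanh B\<close> since \<open>t \<le> r\<close>. This contraction factor is below 1
  uniformly in \<open>r\<close> and \<open>\<beta>\<close>, hence in the matrix size.\<close>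

lemma mean_field_fixed_point:
  fixes \<beta> B r :: real
  assumes \<beta>: "0 \<le> \<beta>" and B: "0 < B" and r: "0 \<le> r"
  obtains t where "0 \<le> t" "t \<le> r" "t = r * tanh (\<beta> * t + B)"
    "\<And>u. 0 \<le> u \<Longrightarrow>
      r * \<bar>tanh (\<beta> * u + B) - tanh (\<beta> * t + B)\<bar> \<le> (1 - tanh B) * \<bar>u - t\<bar>"
proof -
  let ?f = "\<lambda>u. tanh (\<beta> * u + B)"
  have "\<exists>t\<ge>0. t \<le> r \<and> t - r * ?f t = 0"
  proof (rule IVT')
    show "0 - r * ?f 0 \<le> 0" using r B by simp
    have "r * ?f r \<le> r * 1"
      using r tanh_real_lt_1[of "\<beta> * r + B"] by (intro mult_left_mono) auto
    then show "0 \<le> r - r * ?f r" by simp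
    show "continuous_on {0..r} (\<lambda>t. t - r * ?f t)"
      by (intro continuous_intros) simp
  qed (rule r)
  then obtain t where t: "0 \<le> t" "t \<le> r" "t = r * ?f t" by auto
  have "r * \<bar>?f u - ?f t\<bar> \<le> (1 - tanh B) * \<bar>u - t\<bar>" if u: "0 \<le> u" for u
  proof (cases "t = 0")
    case True
    \<comment> \<open>The chord inequality is void at \<open>t = 0\<close>, but there the fixed
      point equation forces \<open>r = 0\<close>.\<close>
    have "?f t > 0" using \<beta> B t(1) by (simp add: add_nonneg_pos)
    with True t(3) have "r = 0" by simp
    then show ?thesis using tanh_real_lt_1[of B] by simp
  next
    case False
    have "mono ?f"
      using \<beta> by (intro monoI) (simp add: mult_left_mono)
    then have "t * \<bar>?f u - ?f t\<bar> \<le> (?f t - ?f 0) * \<bar>u - t\<bar>"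
      using \<beta> B u t(1) by (intro concave_chord_abs_le tanh_shift_concave) auto
    then have "r * (t * \<bar>?f u - ?f t\<bar>) \<le> r * ((?f t - ?f 0) * \<bar>u - t\<bar>)"
      using r by (rule mult_left_mono)
    also have "\<dots> = (t - r * tanh B) * \<bar>u - t\<bar>"
      by (subst (3) t(3)) (simp add: algebra_simps)
    also have "\<dots> \<le> (t - t * tanh B) * \<bar>u - t\<bar>"
      using t(2) B by (intro mult_right_mono) (auto simp: mult_right_mono)
    finally have "t * (r * \<bar>?f u - ?f t\<bar>) \<le> t * ((1 - tanh B) * \<bar>u - t\<bar>)"
      by (simp add: algebra_simps)
    then show ?thesis
      using False t(1) by (simp add: mult_le_cancel_left)
  qed
  with t show ?thesis using that by blast
qed

section \<open>One ferromagnetic matrix of fixed size: monotonicity and basic bounds\<close>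

locale ferromagnet =
  fixes M :: "nat \<Rightarrow> nat \<Rightarrow> real" and n :: nat and \<beta> \<gamma> :: real
  assumes symm: "\<And>i j. i < n \<Longrightarrow> j < n \<Longrightarrow> M i j = M j i"
    and nonneg: "\<And>i j. i < n \<Longrightarrow> j < n \<Longrightarrow> 0 \<le> M i j"
    and diag: "\<And>i. i < n \<Longrightarrow> M i i = 0"
    and row_sum_le: "\<And>i. i < n \<Longrightarrow> row_sum M n i \<le> \<gamma>"
    and \<beta>_nonneg: "0 \<le> \<beta>"
    and n_pos: "0 < n"
begin

abbreviation E where "E \<equiv> ising_expect M n \<beta>"

definition mean_local_field :: "real \<Rightarrow> nat \<Rightarrow> real" where
  "mean_local_field B i = E B (\<lambda>x. local_field M n x i)"

definition var_local_field :: "real \<Rightarrow> nat \<Rightarrow> real" where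
  "var_local_field B i = E B (\<lambda>x. (local_field M n x i - mean_local_field B i)\<^sup>2)"

lemma ising_weight_eq_site_weight:
  "ising_weight M n \<beta> B = site_weight (\<lambda>i j. \<beta> / 2 * M i j) n (\<lambda>_. B)"
  by (intro ext) (simp add: ising_weight_def site_weight_def sum_distrib_left mult_ac)

lemma expect_FKG:
  assumes "mono f" "mono g"
  shows "E B f * E B g \<le> E B (\<lambda>x. f x * g x)"
proof -
  let ?S = "\<lambda>f. \<Sum>x\<in>spins n. ising_weight M n \<beta> B x * f x"
  let ?Z = "ising_Z M n \<beta> B"
  have "?S f * ?S g \<le> ?Z * ?S (\<lambda>x. f x * g x)"
    unfolding ising_Z_def ising_weight_eq_site_weight
    by (rule FKG) (use assms symm nonneg \<beta>_nonneg in auto)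
  then show ?thesis
    using ising_Z_pos[of M n \<beta> B]
    by (simp add: ising_expect_def field_simps)
qed

text \<open>For \<open>B \<le> B'\<close> the tilting function is increasing, so by FKG it is
  non-negatively correlated with \<open>f\<close>.\<close>

lemma expect_mono_field:
  assumes "B \<le> B'" and f: "mono f"
  shows "E B f \<le> E B' f"
proof -
  let ?e = "\<lambda>x. exp ((B' - B) * (\<Sum>i<n. x i :: real))"
  have "mono ?e"
    using assms(1) by (intro monoI) (auto intro!: mult_left_mono sum_mono simp: le_fun_def)
  then have "E B f * E B ?e \<le> E B (\<lambda>x. f x * ?e x)"
    by (rule expect_FKG[OF f])
  moreover have "E B ?e > 0"
    unfolding ising_expect_def
    by (intro divide_pos_pos sum_pos mult_pos_pos ising_weight_pos ising_Z_pos) auto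
  ultimately show ?thesis
    unfolding expect_change_field[of M n \<beta> B' f B] by (simp add: field_simps)
qed

lemma mono_coord: "mono (\<lambda>x. x i :: real)"
  by (intro monoI) (simp add: le_fun_def)

lemma mono_local_field: "i < n \<Longrightarrow> mono (\<lambda>x. local_field M n x i)"
  unfolding local_field_def
  by (intro monoI) (auto intro!: sum_mono mult_left_mono nonneg simp: le_fun_def)

text \<open>At zero field the flip symmetry makes the mean spin vanish, and it can only grow with
  the field.\<close>

lemma expect_spin_nonneg:
  assumes "0 \<le> B" "i < n"
  shows "0 \<le> E B (\<lambda>x. x i)"
proof -
  have "E 0 (\<lambda>x. x i) = E 0 (\<lambda>x. (-1) * x i)"
    using expect_flip_all[of M n \<beta> 0 "\<lambda>x. x i"] assms(2) by simp
  then have "E 0 (\<lambda>x. x i) = 0"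
    unfolding expect_cmult by simp
  then show ?thesis
    using expect_mono_field[OF assms(1) mono_coord, of i] by simp
qed

lemma abs_local_field_le:
  assumes "x \<in> spins n" "i < n"
  shows "\<bar>local_field M n x i\<bar> \<le> \<gamma>"
proof -
  have "\<bar>local_field M n x i\<bar> \<le> (\<Sum>j<n. \<bar>M i j * x j\<bar>)"
    unfolding local_field_def by (rule sum_abs)
  also have "\<dots> = row_sum M n i"
    unfolding row_sum_def using assms
    by (intro sum.cong refl) (simp add: abs_mult spins_abs nonneg)
  finally show ?thesis using row_sum_le[OF assms(2)] by simp
qed

lemma row_sum_nonneg: "i < n \<Longrightarrow> 0 \<le> row_sum M n i"
  unfolding row_sum_def by (intro sum_nonneg nonneg) auto

lemma \<gamma>_nonneg: "0 \<le> \<gamma>"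
  using row_sum_nonneg[OF n_pos] row_sum_le[OF n_pos] by simp

lemma column_sum: "j < n \<Longrightarrow> (\<Sum>i<n. M i j) = row_sum M n j"
  unfolding row_sum_def by (intro sum.cong) (auto simp: symm)

lemma avg_row_sum_bounds: "0 \<le> avg_row_sum M n" "avg_row_sum M n \<le> \<gamma>"
proof -
  show "0 \<le> avg_row_sum M n"
    unfolding avg_row_sum_def by (intro mult_nonneg_nonneg sum_nonneg row_sum_nonneg) auto
  have "(\<Sum>i<n. row_sum M n i) \<le> (\<Sum>i<n. \<gamma>)"
    by (intro sum_mono row_sum_le) simp
  then show "avg_row_sum M n \<le> \<gamma>"
    using n_pos unfolding avg_row_sum_def by (simp add: field_simps)
qed

lemma mean_local_field_eq: "mean_local_field B i = (\<Sum>j<n. M i j * E B (\<lambda>x. x j))"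
  unfolding mean_local_field_def local_field_def by (simp add: expect_sum expect_cmult)

lemma mean_local_field_bounds:
  assumes "0 \<le> B" "i < n"
  shows "0 \<le> mean_local_field B i" "mean_local_field B i \<le> \<gamma>"
proof -
  show "0 \<le> mean_local_field B i"
    unfolding mean_local_field_eq using assms
    by (intro sum_nonneg mult_nonneg_nonneg nonneg expect_spin_nonneg) auto
  have "mean_local_field B i \<le> E B (\<lambda>_. \<gamma>)"
    unfolding mean_local_field_def
    by (rule expect_mono) (use abs_local_field_le[OF _ assms(2)] in fastforce)
  then show "mean_local_field B i \<le> \<gamma>" by simp
qed

section \<open>Spin covariances and the susceptibility\<close>

definition spin_cov :: "real \<Rightarrow> nat \<Rightarrow> nat \<Rightarrow> real" where
  "spin_cov B i j = E B (\<lambda>x. x i * x j) - E B (\<lambda>x. x i) * E B (\<lambda>x. x j)"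

text \<open>The lower bound is FKG; the upper one uses non-negative mean spins. Together they bound
  the square of a covariance by the covariance itself.\<close>

lemma spin_cov_bounds:
  assumes "0 \<le> B" "i < n" "j < n"
  shows "0 \<le> spin_cov B i j" "spin_cov B i j \<le> 1"
proof -
  show "0 \<le> spin_cov B i j"
    unfolding spin_cov_def using expect_FKG[OF mono_coord mono_coord, of B i j] by simp
  have "E B (\<lambda>x. x i * x j) \<le> E B (\<lambda>_. 1)"
  proof (rule expect_mono)
    fix x assume "x \<in> spins n"
    with assms show "x i * x j \<le> 1"
      using spinsD[of x n i] spinsD[of x n j] by auto
  qed
  moreover have "0 \<le> E B (\<lambda>x. x i) * E B (\<lambda>x. x j)"
    using assms by (intro mult_nonneg_nonneg expect_spin_nonneg)
  ultimately show "spin_cov B i j \<le> 1" by (simp add: spin_cov_def)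
qed

text \<open>The derivative of the expected total spin in the field is its variance, so the mean
  value theorem yields a nearby field of small variance.\<close>

lemma exists_small_susceptibility:
  assumes "B < B'"
  obtains \<xi> where "B < \<xi>" "\<xi> < B'" "(\<Sum>i<n. \<Sum>j<n. spin_cov \<xi> i j) \<le> 2 * real n / (B' - B)"
proof -
  let ?S = "\<lambda>x. \<Sum>i<n. x i :: real"
  obtain \<xi> where \<xi>: "B < \<xi>" "\<xi> < B'"
      "E B' ?S - E B ?S = (B' - B) * (E \<xi> (\<lambda>x. ?S x * ?S x) - E \<xi> ?S * E \<xi> ?S)"
    using MVT2[OF assms expect_has_field_derivative[where M = M and n = n and \<beta> = \<beta> and f = ?S]]
    by blast
  have cov: "(\<Sum>i<n. \<Sum>j<n. spin_cov \<xi> i j) = E \<xi> (\<lambda>x. ?S x * ?S x) - E \<xi> ?S * E \<xi> ?S"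
    unfolding spin_cov_def sum_product by (simp add: expect_sum sum_subtractf sum_product)
  have b: "\<bar>E C ?S\<bar> \<le> real n" for C
  proof -
    have "E C (\<lambda>x. \<bar>?S x\<bar>) \<le> E C (\<lambda>_. real n)"
    proof (rule expect_mono)
      fix x assume x: "x \<in> spins n"
      have "\<bar>?S x\<bar> \<le> (\<Sum>i<n. \<bar>x i\<bar>)" by (rule sum_abs)
      also have "\<dots> = real n" using x by (simp add: spins_abs)
      finally show "\<bar>?S x\<bar> \<le> real n" .
    qed
    then show ?thesis using expect_abs_le[of M n \<beta> C ?S] by simp
  qed
  have "(B' - B) * (\<Sum>i<n. \<Sum>j<n. spin_cov \<xi> i j) \<le> 2 * real n"
    unfolding cov \<xi>(3)[symmetric] using b[of B] b[of B'] by linarith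
  then have "(\<Sum>i<n. \<Sum>j<n. spin_cov \<xi> i j) \<le> 2 * real n / (B' - B)"
    using assms by (simp add: field_simps)
  with \<xi>(1,2) that show ?thesis by blast
qed

section \<open>Variances of the local fields and distance of their means to the fixed point\<close>

text \<open>The left side is the squared Frobenius norm of the Gram matrix of the columns.
  Cauchy-Schwarz and the row sum bound, used twice, reduce it to the norm that the mean field
  condition controls.\<close>

lemma sum_gram_power2_le:
  "(\<Sum>j<n. \<Sum>k<n. (\<Sum>i<n. M i j * M i k)\<^sup>2) \<le> \<gamma>\<^sup>2 * (\<Sum>i<n. \<Sum>j<n. (M i j)\<^sup>2)"
proof -
  have cs: "(\<Sum>i<n. M i j * M i k)\<^sup>2 \<le> \<gamma> * (\<Sum>i<n. M i j * (M i k)\<^sup>2)" if "j < n" "k < n" for j k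
  proof -
    \<comment> \<open>Splitting \<open>M i j\<close> into two square roots makes this Cauchy-Schwarz
      with respect to the weights \<open>M i j\<close> in \<open>i\<close>.\<close>
    have "(\<Sum>i<n. M i j * M i k)\<^sup>2 = (\<Sum>i<n. sqrt (M i j) * (sqrt (M i j) * M i k))\<^sup>2"
      using that nonneg by (intro arg_cong[where f = "\<lambda>s. s\<^sup>2"] sum.cong) (auto simp: mult.assoc[symmetric])
    also have "\<dots> \<le> (\<Sum>i<n. (sqrt (M i j))\<^sup>2) * (\<Sum>i<n. (sqrt (M i j) * M i k)\<^sup>2)"
      by (rule Cauchy_Schwarz_ineq_sum)
    also have "\<dots> = row_sum M n j * (\<Sum>i<n. M i j * (M i k)\<^sup>2)"
      using that nonneg by (simp add: power_mult_distrib column_sum)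
    also have "\<dots> \<le> \<gamma> * (\<Sum>i<n. M i j * (M i k)\<^sup>2)"
      using that by (intro mult_right_mono row_sum_le sum_nonneg mult_nonneg_nonneg nonneg) auto
    finally show ?thesis .
  qed
  have "(\<Sum>j<n. \<Sum>k<n. (\<Sum>i<n. M i j * M i k)\<^sup>2) \<le> (\<Sum>j<n. \<Sum>k<n. \<gamma> * (\<Sum>i<n. M i j * (M i k)\<^sup>2))"
    by (intro sum_mono cs) auto
  also have "\<dots> = \<gamma> * (\<Sum>k<n. \<Sum>j<n. \<Sum>i<n. M i j * (M i k)\<^sup>2)"
    by (subst sum.swap) (simp add: sum_distrib_left)
  also have "\<dots> = \<gamma> * (\<Sum>k<n. \<Sum>i<n. row_sum M n i * (M i k)\<^sup>2)"
    unfolding row_sum_def sum_distrib_right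
    by (rule arg_cong[where f = "(*) \<gamma>"], rule sum.cong[OF refl], rule sum.swap)
  also have "\<dots> \<le> \<gamma> * (\<Sum>k<n. \<Sum>i<n. \<gamma> * (M i k)\<^sup>2)"
    using \<gamma>_nonneg by (intro mult_left_mono sum_mono mult_right_mono row_sum_le) auto
  also have "\<dots> = \<gamma>\<^sup>2 * (\<Sum>i<n. \<Sum>j<n. (M i j)\<^sup>2)"
    by (subst sum.swap) (simp add: sum_distrib_left power2_eq_square mult.assoc)
  finally show ?thesis .
qed

lemma var_local_field_eq:
  "var_local_field B i = (\<Sum>j<n. \<Sum>k<n. M i j * M i k * spin_cov B j k)"
proof -
  let ?z = "\<lambda>x j. x j - E B (\<lambda>x. x j)"
  have z: "local_field M n x i - mean_local_field B i = (\<Sum>j<n. M i j * ?z x j)" for x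
    unfolding mean_local_field_eq local_field_def sum_subtractf[symmetric]
    by (simp add: algebra_simps)
  have "(\<Sum>j<n. M i j * ?z x j)\<^sup>2 = (\<Sum>j<n. \<Sum>k<n. M i j * M i k * (?z x j * ?z x k))" for x
    unfolding power2_eq_square sum_product by (simp add: mult_ac)
  then show ?thesis
    unfolding var_local_field_def z spin_cov_def
    by (simp add: expect_sum expect_cmult expect_centered_prod)
qed

text \<open>The total variance is the Frobenius inner product of the Gram matrix \<open>D\<close>
  with the covariance matrix \<open>C\<close>, so Cauchy-Schwarz separates the matrix from the
  susceptibility.\<close>

lemma sum_var_local_field_le:
  assumes "0 \<le> B" and var: "(\<Sum>i<n. \<Sum>j<n. spin_cov B i j) \<le> v"
  shows "(\<Sum>i<n. var_local_field B i) \<le> \<gamma> * sqrt ((\<Sum>i<n. \<Sum>j<n. (M i j)\<^sup>2) * v)"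
proof -
  define D where "D = (\<lambda>(j, k). \<Sum>i<n. M i j * M i k)"
  define C where "C = (\<lambda>(j, k). spin_cov B j k)"
  let ?P = "{..<n} \<times> {..<n}"
  have "(\<Sum>i<n. var_local_field B i) = (\<Sum>j<n. \<Sum>k<n. \<Sum>i<n. M i j * M i k * spin_cov B j k)"
    unfolding var_local_field_eq
    by (rule trans[OF sum.swap], rule sum.cong[OF refl], rule sum.swap)
  also have "\<dots> = (\<Sum>p\<in>?P. D p * C p)"
    unfolding sum_distrib_right[symmetric] sum.cartesian_product D_def C_def
    by (simp add: case_prod_unfold)
  finally have 1: "(\<Sum>i<n. var_local_field B i) = (\<Sum>p\<in>?P. D p * C p)" .
  have 2: "(\<Sum>p\<in>?P. (D p)\<^sup>2) \<le> \<gamma>\<^sup>2 * (\<Sum>i<n. \<Sum>j<n. (M i j)\<^sup>2)"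
    using sum_gram_power2_le by (simp add: sum.cartesian_product D_def case_prod_unfold)
  \<comment> \<open>Covariances lie between 0 and 1, hence dominate their squares.\<close>
  have "(\<Sum>p\<in>?P. (C p)\<^sup>2) \<le> (\<Sum>p\<in>?P. C p)"
    using assms(1) spin_cov_bounds
    by (intro sum_mono) (auto simp: C_def power2_eq_square mult_left_le)
  also have "\<dots> \<le> v"
    using var by (simp add: sum.cartesian_product C_def)
  finally have 3: "(\<Sum>p\<in>?P. (C p)\<^sup>2) \<le> v" .
  have "(\<Sum>p\<in>?P. D p * C p)\<^sup>2 \<le> (\<Sum>p\<in>?P. (D p)\<^sup>2) * (\<Sum>p\<in>?P. (C p)\<^sup>2)"
    by (rule Cauchy_Schwarz_ineq_sum)
  also have "\<dots> \<le> (\<gamma>\<^sup>2 * (\<Sum>i<n. \<Sum>j<n. (M i j)\<^sup>2)) * v"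
    by (intro mult_mono 2 3 sum_nonneg mult_nonneg_nonneg) auto
  finally have "(\<Sum>p\<in>?P. D p * C p) \<le> sqrt (\<gamma>\<^sup>2 * ((\<Sum>i<n. \<Sum>j<n. (M i j)\<^sup>2) * v))"
    by (intro real_le_rsqrt) (simp add: mult.assoc)
  then show ?thesis
    unfolding 1 real_sqrt_mult[of "\<gamma>\<^sup>2"] using \<gamma>_nonneg by simp
qed

text \<open>An L1 rather than L2 comparison: the column sums equal the row sums, and these are close to
  their average \<open>r\<close> on average although not uniformly.\<close>

lemma mean_local_field_L1:
  fixes r t B \<xi> K \<delta> :: real
  defines "r \<equiv> avg_row_sum M n"
  assumes B: "0 < B" and \<xi>: "0 < \<xi>" "\<bar>\<xi> - B\<bar> \<le> \<delta>"
    and K: "(\<Sum>i<n. var_local_field \<xi> i) \<le> real n * K"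
    and t: "t = r * tanh (\<beta> * t + B)" "0 \<le> t"
    and contr: "\<And>u. 0 \<le> u \<Longrightarrow>
      r * \<bar>tanh (\<beta> * u + B) - tanh (\<beta> * t + B)\<bar> \<le> (1 - tanh B) * \<bar>u - t\<bar>"
  shows "tanh B * (\<Sum>i<n. \<bar>mean_local_field \<xi> i - t\<bar>)
    \<le> 2 * (\<Sum>i<n. \<bar>row_sum M n i - r\<bar>) + real n * (\<gamma> * (\<beta> * sqrt K + \<delta>))"
proof -
  let ?u = "mean_local_field \<xi>" and ?R = "row_sum M n"
  let ?f = "\<lambda>u. tanh (\<beta> * u + B)"
  \<comment> \<open>\<open>e j\<close> is the error in the mean field equation for the mean spin at
    \<open>j\<close>; \<open>d j\<close> is the mean absolute fluctuation of the local
    field.\<close>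
  define e where "e j = E \<xi> (\<lambda>x. x j) - ?f (?u j)" for j
  define d where "d j = E \<xi> (\<lambda>x. \<bar>local_field M n x j - ?u j\<bar>)" for j
  have d_nonneg: "0 \<le> d j" for j
    unfolding d_def by (rule expect_nonneg) simp
  \<comment> \<open>Cauchy-Schwarz over the sites, then Jensen at each site.\<close>
  have d: "(\<Sum>j<n. d j) \<le> real n * sqrt K"
  proof -
    have "(\<Sum>j<n. d j)\<^sup>2 \<le> (\<Sum>j<n. (d j)\<^sup>2) * real n"
      using sum_squared_le_sum_of_squares[of d "{..<n}"] by simp
    also have "\<dots> \<le> (\<Sum>j<n. var_local_field \<xi> j) * real n"
    proof (intro mult_right_mono sum_mono)
      show "(d j)\<^sup>2 \<le> var_local_field \<xi> j" for j
        unfolding d_def var_local_field_def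
        using expect_power2_le[of M n \<beta> \<xi> "\<lambda>x. \<bar>local_field M n x j - ?u j\<bar>"] by simp
    qed simp
    also have "\<dots> \<le> (real n * K) * real n"
      by (intro mult_right_mono K) simp
    finally have "(\<Sum>j<n. d j) \<le> sqrt ((real n)\<^sup>2 * K)"
      by (intro real_le_rsqrt) (simp add: power2_eq_square mult_ac)
    then show ?thesis by (simp add: real_sqrt_mult)
  qed
  \<comment> \<open>The \<open>tanh\<close> identity is exact at the field \<open>\<xi>\<close>. As
    \<open>tanh\<close> is 1-Lipschitz, replacing the local field by its mean costs
    \<open>\<beta> * d j\<close>, and replacing \<open>\<xi>\<close> by \<open>B\<close> costs
    \<open>\<delta>\<close>.\<close>
  have e: "\<bar>e j\<bar> \<le> \<beta> * d j + \<delta>" if j: "j < n" for j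
  proof -
    have "\<bar>e j\<bar> = \<bar>E \<xi> (\<lambda>x. tanh (\<beta> * local_field M n x j + \<xi>) - ?f (?u j))\<bar>"
      unfolding e_def using expect_spin_eq_tanh[of n M j \<beta> \<xi>] symm diag j
      by (simp add: expect_diff)
    also have "\<dots> \<le> E \<xi> (\<lambda>x. \<bar>tanh (\<beta> * local_field M n x j + \<xi>) - ?f (?u j)\<bar>)"
      by (rule expect_abs_le)
    also have "\<dots> \<le> E \<xi> (\<lambda>x. \<beta> * \<bar>local_field M n x j - ?u j\<bar> + \<delta>)"
    proof (rule expect_mono)
      fix x
      have "\<bar>tanh (\<beta> * local_field M n x j + \<xi>) - ?f (?u j)\<bar>
          \<le> \<bar>\<beta> * (local_field M n x j - ?u j) + (\<xi> - B)\<bar>"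
        using tanh_lipschitz[of "\<beta> * local_field M n x j + \<xi>" "\<beta> * ?u j + B"]
        by (simp only: right_diff_distrib add_diff_add)
      also have "\<dots> \<le> \<beta> * \<bar>local_field M n x j - ?u j\<bar> + \<delta>"
        using \<xi>(2) abs_triangle_ineq[of "\<beta> * (local_field M n x j - ?u j)" "\<xi> - B"] \<beta>_nonneg
        by (simp add: abs_mult)
      finally show "\<bar>tanh (\<beta> * local_field M n x j + \<xi>) - ?f (?u j)\<bar> \<le> \<dots>" .
    qed
    finally show ?thesis by (simp add: expect_add expect_cmult d_def)
  qed
  have u: "0 \<le> ?u j" if "j < n" for j
    using mean_local_field_bounds(1) \<xi>(1) that by simp
  have f01: "0 \<le> ?f v" "?f v \<le> 1" if "0 \<le> v" for v
    using that B \<beta>_nonneg tanh_real_lt_1[of "\<beta> * v + B"] by auto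
  have dev: "\<bar>?u i - t\<bar> \<le> (\<Sum>j<n. M i j * (\<bar>?f (?u j) - ?f t\<bar> + \<bar>e j\<bar>)) + \<bar>?R i - r\<bar>"
    if i: "i < n" for i
  proof -
    have dec: "?u i - t = (\<Sum>j<n. M i j * ((?f (?u j) - ?f t) + e j)) + (?R i - r) * ?f t"
    proof -
      have "?u i = (\<Sum>j<n. M i j * ((?f (?u j) - ?f t) + e j) + M i j * ?f t)"
        unfolding mean_local_field_eq[of \<xi> i] e_def
        by (intro sum.cong refl) (simp add: algebra_simps)
      then have "?u i = (\<Sum>j<n. M i j * ((?f (?u j) - ?f t) + e j)) + ?R i * ?f t"
        by (simp only: sum.distrib row_sum_def sum_distrib_right)
      moreover have "(?R i - r) * ?f t = ?R i * ?f t - t"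
        unfolding left_diff_distrib using t(1)[symmetric] by (simp only:)
        ultimately show ?thesis by linarith
    qed
    have 1: "\<bar>(\<Sum>j<n. M i j * ((?f (?u j) - ?f t) + e j))\<bar>
      \<le> (\<Sum>j<n. M i j * (\<bar>?f (?u j) - ?f t\<bar> + \<bar>e j\<bar>))"
    proof (rule order_trans[OF sum_abs], rule sum_mono)
      fix j assume "j \<in> {..<n}"
      then show "\<bar>M i j * ((?f (?u j) - ?f t) + e j)\<bar> \<le> M i j * (\<bar>?f (?u j) - ?f t\<bar> + \<bar>e j\<bar>)"
        using nonneg[OF i, of j] by (simp add: abs_mult mult_left_mono)
    qed
    have 2: "\<bar>(?R i - r) * ?f t\<bar> \<le> \<bar>?R i - r\<bar> * 1"
      unfolding abs_mult using f01[OF t(2)] by (intro mult_left_mono) auto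
    show ?thesis
      unfolding dec by (rule order_trans[OF abs_triangle_ineq add_mono[OF 1 2[unfolded mult_1_right]]])
  qed
  have "(\<Sum>i<n. \<bar>?u i - t\<bar>)
      \<le> (\<Sum>i<n. (\<Sum>j<n. M i j * (\<bar>?f (?u j) - ?f t\<bar> + \<bar>e j\<bar>)) + \<bar>?R i - r\<bar>)"
    by (intro sum_mono dev) auto
  \<comment> \<open>Swapping the sums produces column sums, which symmetry turns into row
    sums.\<close>
  also have "\<dots> = (\<Sum>j<n. ?R j * (\<bar>?f (?u j) - ?f t\<bar> + \<bar>e j\<bar>)) + (\<Sum>i<n. \<bar>?R i - r\<bar>)"
    unfolding sum.distrib
    by (subst sum.swap) (simp add: column_sum flip: sum_distrib_right)
  also have "\<dots> \<le> (\<Sum>j<n. (1 - tanh B) * \<bar>?u j - t\<bar> + \<bar>?R j - r\<bar> + \<gamma> * (\<beta> * d j + \<delta>))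
      + (\<Sum>i<n. \<bar>?R i - r\<bar>)"
  proof (intro add_right_mono sum_mono)
    fix j assume "j \<in> {..<n}"
    then have j: "j < n" by simp
    \<comment> \<open>The contraction is available for the average \<open>r\<close> only; the
      remainder \<open>?R j - r\<close> contributes a second copy of the row sum deviation.\<close>
    have "?R j * \<bar>?f (?u j) - ?f t\<bar> = r * \<bar>?f (?u j) - ?f t\<bar> + (?R j - r) * \<bar>?f (?u j) - ?f t\<bar>"
      by (simp add: algebra_simps)
    moreover have "(?R j - r) * \<bar>?f (?u j) - ?f t\<bar> \<le> \<bar>?R j - r\<bar> * 1"
    proof (intro mult_mono)
      show "\<bar>?f (?u j) - ?f t\<bar> \<le> 1"
        using f01[OF t(2)] f01[OF u[OF j]] by linarith
    qed auto
    moreover have "r * \<bar>?f (?u j) - ?f t\<bar> \<le> (1 - tanh B) * \<bar>?u j - t\<bar>"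
      by (rule contr[OF u[OF j]])
    ultimately have "?R j * \<bar>?f (?u j) - ?f t\<bar> \<le> (1 - tanh B) * \<bar>?u j - t\<bar> + \<bar>?R j - r\<bar>"
      by linarith
    moreover have "?R j * \<bar>e j\<bar> \<le> \<gamma> * (\<beta> * d j + \<delta>)"
      using e[OF j] row_sum_le[OF j] \<gamma>_nonneg by (intro mult_mono) auto
    ultimately show "?R j * (\<bar>?f (?u j) - ?f t\<bar> + \<bar>e j\<bar>)
        \<le> (1 - tanh B) * \<bar>?u j - t\<bar> + \<bar>?R j - r\<bar> + \<gamma> * (\<beta> * d j + \<delta>)"
      by (simp add: distrib_left)
  qed
  also have "\<dots> = ((1 - tanh B) * (\<Sum>i<n. \<bar>?u i - t\<bar>) + 2 * (\<Sum>i<n. \<bar>?R i - r\<bar>))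
      + \<gamma> * (\<beta> * (\<Sum>j<n. d j) + real n * \<delta>)"
    by (simp add: sum.distrib sum_distrib_left[symmetric])
  also have "\<dots> \<le> ((1 - tanh B) * (\<Sum>i<n. \<bar>?u i - t\<bar>) + 2 * (\<Sum>i<n. \<bar>?R i - r\<bar>))
      + \<gamma> * (\<beta> * (real n * sqrt K) + real n * \<delta>)"
    using d \<gamma>_nonneg \<beta>_nonneg by (intro add_left_mono mult_left_mono add_right_mono) auto
  \<comment> \<open>Absorbing the contracted sum on the left leaves the factor
    \<open>tanh B\<close>.\<close>
  finally show ?thesis by (simp add: algebra_simps)
qed

section \<open>From the local fields to the expectation of \<open>T_stat\<close>\<close>

text \<open>The empirical mean minimises the sum of squared deviations, so it may be replaced by the
  deterministic fixed point.\<close>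

lemma T_stat_le:
  "T_stat M n x \<le> (1 / real n) * (\<Sum>i<n. (local_field M n x i - t)\<^sup>2)"
proof -
  let ?m = "local_field M n x" and ?a = "avg_local_field M n x"
  have s: "(\<Sum>i<n. ?m i) = real n * ?a"
    using n_pos by (simp add: avg_local_field_def)
  have sq: "(\<Sum>i<n. (?m i - c)\<^sup>2) = (\<Sum>i<n. (?m i)\<^sup>2) - 2 * c * (\<Sum>i<n. ?m i) + real n * c\<^sup>2" for c
    by (simp add: power2_diff sum.distrib sum_subtractf sum_distrib_left mult_ac)
  have "(\<Sum>i<n. (?m i - t)\<^sup>2) - (\<Sum>i<n. (?m i - ?a)\<^sup>2) = real n * (?a - t)\<^sup>2"
    unfolding sq s by (simp add: power2_eq_square algebra_simps)
  moreover have "0 \<le> real n * (?a - t)\<^sup>2" by simp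
  ultimately have "(\<Sum>i<n. (?m i - ?a)\<^sup>2) \<le> (\<Sum>i<n. (?m i - t)\<^sup>2)" by linarith
  then show ?thesis
    unfolding T_stat_def by (intro mult_left_mono) auto
qed

text \<open>Shifting by \<open>\<gamma>\<close> makes the square increasing in the spins, so both terms of the
  expanded square can be moved to nearby fields \<open>B' \<le> B \<le> B''\<close>.\<close>

lemma expect_square_dev_le:
  assumes B: "0 \<le> B'" "B' \<le> B" "B \<le> B''" and t: "0 \<le> t" "t \<le> \<gamma>" and i: "i < n"
  shows "E B (\<lambda>x. (local_field M n x i - t)\<^sup>2) \<le> var_local_field B'' i
    + 5 * \<gamma> * \<bar>mean_local_field B'' i - t\<bar> + 4 * \<gamma> * \<bar>mean_local_field B' i - t\<bar>"
proof -
  let ?m = "\<lambda>x. local_field M n x i" and ?u = "\<lambda>B. mean_local_field B i"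
  let ?s = "t + \<gamma>"
  \<comment> \<open>The shifted square enters with coefficient 1 and the mean with a non-positive
    one; so the square is compared with the upper field \<open>B''\<close> and the mean with the
    lower field \<open>B'\<close>.\<close>
  have sq: "E C (\<lambda>x. (?m x - t)\<^sup>2) = E C (\<lambda>x. (?m x + \<gamma>)\<^sup>2) - 2 * ?s * (?u C + \<gamma>) + ?s\<^sup>2" for C
  proof -
    have "E C (\<lambda>x. (?m x - t)\<^sup>2) = E C (\<lambda>x. (?m x + \<gamma>)\<^sup>2 - (2 * ?s) * (?m x + \<gamma>) + ?s\<^sup>2)"
      by (rule expect_cong) (simp add: power2_eq_square algebra_simps)
    also have "\<dots> = E C (\<lambda>x. (?m x + \<gamma>)\<^sup>2) - (2 * ?s) * (E C ?m + \<gamma>) + ?s\<^sup>2"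
      unfolding expect_add expect_diff expect_cmult by simp
    finally show ?thesis by (simp add: mean_local_field_def)
  qed
  have var: "E C (\<lambda>x. (?m x - t)\<^sup>2) = var_local_field C i + (?u C - t)\<^sup>2" for C
  proof -
    have "E C (\<lambda>x. (?m x - t)\<^sup>2) =
        E C (\<lambda>x. (?m x - ?u C)\<^sup>2 + (2 * (?u C - t)) * (?m x - ?u C) + (?u C - t)\<^sup>2)"
      by (rule expect_cong) (simp add: power2_eq_square algebra_simps)
    also have "\<dots> = var_local_field C i + (2 * (?u C - t)) * (E C ?m - ?u C) + (?u C - t)\<^sup>2"
      unfolding expect_add expect_diff expect_cmult var_local_field_def by simp
    finally show ?thesis by (simp add: mean_local_field_def)
  qed
  have m1: "?u B' \<le> ?u B"
    unfolding mean_local_field_def by (intro expect_mono_field B mono_local_field i)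
  have m2: "E B (\<lambda>x. (?m x + \<gamma>)\<^sup>2) \<le> E B'' (\<lambda>x. (?m x + \<gamma>)\<^sup>2)"
  proof -
    \<comment> \<open>Monotonicity concerns all real functions, so the shifted field is truncated at
      0; on \<open>spins n\<close> it is already non-negative and the truncation changes
      nothing.\<close>
    have "mono (\<lambda>x. (max 0 (?m x + \<gamma>))\<^sup>2)"
      using monoD[OF mono_local_field[OF i]]
      by (intro monoI power_mono) (auto simp: max_def intro: add_mono order_trans)
    then have "E B (\<lambda>x. (max 0 (?m x + \<gamma>))\<^sup>2) \<le> E B'' (\<lambda>x. (max 0 (?m x + \<gamma>))\<^sup>2)"
      by (intro expect_mono_field B)
    moreover have "E C (\<lambda>x. (max 0 (?m x + \<gamma>))\<^sup>2) = E C (\<lambda>x. (?m x + \<gamma>)\<^sup>2)" for C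
      by (rule expect_cong) (use abs_local_field_le[OF _ i] in \<open>fastforce simp: max_def\<close>)
    ultimately show ?thesis by simp
  qed
  have "E B (\<lambda>x. (?m x - t)\<^sup>2) \<le> E B'' (\<lambda>x. (?m x - t)\<^sup>2) + 2 * ?s * (?u B'' - ?u B')"
  proof -
    have "?s * ?u B' \<le> ?s * ?u B"
      using m1 t \<gamma>_nonneg by (intro mult_left_mono) auto
    then show ?thesis
      unfolding sq using m2 by (simp add: algebra_simps)
  qed
  moreover have "2 * ?s * (?u B'' - ?u B') \<le> 4 * \<gamma> * (\<bar>?u B'' - t\<bar> + \<bar>?u B' - t\<bar>)"
  proof -
    have "2 * ?s * (?u B'' - ?u B') \<le> 2 * ?s * (\<bar>?u B'' - t\<bar> + \<bar>?u B' - t\<bar>)"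
      using t \<gamma>_nonneg by (intro mult_left_mono) auto
    also have "\<dots> \<le> 4 * \<gamma> * (\<bar>?u B'' - t\<bar> + \<bar>?u B' - t\<bar>)"
      using t by (intro mult_right_mono) auto
    finally show ?thesis .
  qed
  \<comment> \<open>The squared bias adds one more \<open>\<gamma>\<close> to the
    \<open>4 * \<gamma>\<close> above, whence the \<open>5 * \<gamma>\<close>.\<close>
  moreover have "(?u B'' - t)\<^sup>2 \<le> \<gamma> * \<bar>?u B'' - t\<bar>"
  proof -
    have "\<bar>?u B'' - t\<bar> \<le> \<gamma>"
      using mean_local_field_bounds[OF _ i, of B''] B t by auto
    then have "\<bar>?u B'' - t\<bar> * \<bar>?u B'' - t\<bar> \<le> \<gamma> * \<bar>?u B'' - t\<bar>"
      by (rule mult_right_mono) simp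
    then show ?thesis by (simp add: power2_eq_square)
  qed
  ultimately show ?thesis
    unfolding var[of B''] by (simp add: algebra_simps)
qed

text \<open>The window width \<open>\<delta>\<close> is where the nearby fields are sought. For
  fixed \<open>\<delta>\<close> the bound becomes a multiple of \<open>\<delta>\<close> once
  \<open>\<eta>\<close> and \<open>\<rho>\<close> vanish; \<open>K\<close> bounds the average
  variance of the local fields there.\<close>

lemma expect_T_stat_le:
  fixes B \<delta> :: real
  defines "\<eta> \<equiv> (1 / real n) * (\<Sum>i<n. \<Sum>j<n. (M i j)\<^sup>2)"
    and "\<rho> \<equiv> (1 / real n) * (\<Sum>i<n. (row_sum M n i - avg_row_sum M n)\<^sup>2)"
  defines "K \<equiv> \<gamma> * sqrt (2 * \<eta> / \<delta>)"
  assumes \<delta>: "0 < \<delta>" "\<delta> < B"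
  shows "E B (T_stat M n) \<le> K + 9 * \<gamma> / tanh B * (2 * sqrt \<rho> + \<gamma> * (\<beta> * sqrt K + \<delta>))"
proof -
  define r where "r = avg_row_sum M n"
  have B: "0 < B" using \<delta> by simp
  note r = avg_row_sum_bounds[folded r_def]
  obtain t where t: "0 \<le> t" "t \<le> r" "t = r * tanh (\<beta> * t + B)"
    "\<And>u. 0 \<le> u \<Longrightarrow> r * \<bar>tanh (\<beta> * u + B) - tanh (\<beta> * t + B)\<bar> \<le> (1 - tanh B) * \<bar>u - t\<bar>"
    using mean_field_fixed_point[OF \<beta>_nonneg B r(1)] by blast
  have var: "(\<Sum>i<n. var_local_field \<xi> i) \<le> real n * K"
    if "0 \<le> \<xi>" "(\<Sum>i<n. \<Sum>j<n. spin_cov \<xi> i j) \<le> 2 * real n / \<delta>" for \<xi>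
  proof -
    have "(\<Sum>i<n. \<Sum>j<n. (M i j)\<^sup>2) * (2 * real n / \<delta>) = (real n)\<^sup>2 * (2 * \<eta> / \<delta>)"
      unfolding \<eta>_def using n_pos by (simp add: power2_eq_square)
    then have "sqrt ((\<Sum>i<n. \<Sum>j<n. (M i j)\<^sup>2) * (2 * real n / \<delta>)) = real n * sqrt (2 * \<eta> / \<delta>)"
      by (simp only: real_sqrt_mult) simp
    then show ?thesis
      using sum_var_local_field_le[OF that] by (simp add: K_def mult_ac)
  qed
  \<comment> \<open>An interval of length \<open>\<delta>\<close> on each side of \<open>B\<close>;
    \<open>\<delta> < B\<close> keeps the lower field positive.\<close>
  obtain B' where B': "B - \<delta> < B'" "B' < B" "(\<Sum>i<n. \<Sum>j<n. spin_cov B' i j) \<le> 2 * real n / \<delta>"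
    using exists_small_susceptibility[of "B - \<delta>" B] \<delta> by auto
  obtain B'' where B'': "B < B''" "B'' < B + \<delta>" "(\<Sum>i<n. \<Sum>j<n. spin_cov B'' i j) \<le> 2 * real n / \<delta>"
    using exists_small_susceptibility[of B "B + \<delta>"] \<delta> by auto
  define L where "L = (2 * sqrt \<rho> + \<gamma> * (\<beta> * sqrt K + \<delta>)) / tanh B"
  have L1: "(\<Sum>i<n. \<bar>row_sum M n i - r\<bar>) \<le> real n * sqrt \<rho>"
  proof -
    have "(\<Sum>i<n. \<bar>row_sum M n i - r\<bar>)\<^sup>2 \<le> (\<Sum>i<n. \<bar>row_sum M n i - r\<bar>\<^sup>2) * real n"
      using sum_squared_le_sum_of_squares[of "\<lambda>i. \<bar>row_sum M n i - r\<bar>" "{..<n}"] by simp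
    also have "\<dots> = (real n)\<^sup>2 * \<rho>"
      unfolding \<rho>_def r_def using n_pos by (simp add: power2_eq_square)
    finally have "(\<Sum>i<n. \<bar>row_sum M n i - r\<bar>) \<le> sqrt ((real n)\<^sup>2 * \<rho>)"
      by (rule real_le_rsqrt)
    then show ?thesis by (simp add: real_sqrt_mult)
  qed
  have L: "(\<Sum>i<n. \<bar>mean_local_field \<xi> i - t\<bar>) \<le> real n * L"
    if "0 < \<xi>" "\<bar>\<xi> - B\<bar> \<le> \<delta>" "(\<Sum>i<n. \<Sum>j<n. spin_cov \<xi> i j) \<le> 2 * real n / \<delta>" for \<xi>
  proof -
    have "tanh B * (\<Sum>i<n. \<bar>mean_local_field \<xi> i - t\<bar>)
      \<le> 2 * (\<Sum>i<n. \<bar>row_sum M n i - r\<bar>) + real n * (\<gamma> * (\<beta> * sqrt K + \<delta>))"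
      unfolding r_def
      by (rule mean_local_field_L1[OF B that(1,2) var]) (use that t in \<open>auto simp: r_def\<close>)
    also have "\<dots> \<le> real n * (2 * sqrt \<rho> + \<gamma> * (\<beta> * sqrt K + \<delta>))"
      using L1 by (simp add: algebra_simps)
    finally show ?thesis
      using B by (simp add: L_def field_simps)
  qed
  have "E B (T_stat M n) \<le> E B (\<lambda>x. (1 / real n) * (\<Sum>i<n. (local_field M n x i - t)\<^sup>2))"
    by (rule expect_mono) (rule T_stat_le)
  also have "\<dots> = (1 / real n) * (\<Sum>i<n. E B (\<lambda>x. (local_field M n x i - t)\<^sup>2))"
    unfolding expect_cmult expect_sum ..
  also have "\<dots> \<le> (1 / real n) * (\<Sum>i<n. var_local_field B'' i
    + 5 * \<gamma> * \<bar>mean_local_field B'' i - t\<bar> + 4 * \<gamma> * \<bar>mean_local_field B' i - t\<bar>)"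
    using B' B'' t r \<delta> by (intro mult_left_mono sum_mono expect_square_dev_le) auto
  also have "\<dots> = (1 / real n) * ((\<Sum>i<n. var_local_field B'' i)
    + 5 * \<gamma> * (\<Sum>i<n. \<bar>mean_local_field B'' i - t\<bar>) + 4 * \<gamma> * (\<Sum>i<n. \<bar>mean_local_field B' i - t\<bar>))"
    by (simp add: sum.distrib sum_distrib_left)
  also have "\<dots> \<le> (1 / real n) * (real n * K + 5 * \<gamma> * (real n * L) + 4 * \<gamma> * (real n * L))"
    using B' B'' \<delta> \<gamma>_nonneg by (intro mult_left_mono add_mono var L) auto
  also have "\<dots> = K + 9 * \<gamma> * L"
    using n_pos by (simp add: field_simps)
  finally show ?thesis by (simp add: L_def)
qed

end

section \<open>Convergence in probability\<close>

lemma T_stat_nonneg: "0 \<le> T_stat M n x"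
  unfolding T_stat_def by (simp add: sum_nonneg)

text \<open>Local fields are odd in the spins and the statistic is quadratic in them.\<close>

lemma T_stat_flip_all: "T_stat M n (flip_all n x) = T_stat M n x"
proof -
  have lf: "local_field M n (flip_all n x) i = - local_field M n x i" for i
    unfolding local_field_def by (simp add: sum_negf)
  then have "avg_local_field M n (flip_all n x) = - avg_local_field M n x"
    unfolding avg_local_field_def by (simp add: sum_negf)
  then show ?thesis
    unfolding T_stat_def lf
    by (intro arg_cong[where f = "\<lambda>s. 1 / real n * s"] sum.cong refl) (simp add: power2_eq_square algebra_simps)
qed

theorem theorem3:
  fixes A :: "nat \<Rightarrow> nat \<Rightarrow> nat \<Rightarrow> real"
  assumes symm: "\<And>n i j. i < n \<Longrightarrow> j < n \<Longrightarrow> A n i j = A n j i"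
    and nonneg: "\<And>n i j. i < n \<Longrightarrow> j < n \<Longrightarrow> 0 \<le> A n i j"
    and diag: "\<And>n i. i < n \<Longrightarrow> A n i i = 0"
    and C1: "\<exists>\<gamma>. \<forall>n i. i < n \<longrightarrow> row_sum (A n) n i \<le> \<gamma>"
    and mean_field: "(\<lambda>n. (1 / real n) * (\<Sum>i<n. \<Sum>j<n. (A n i j)\<^sup>2)) \<longlonglongrightarrow> 0"
    and regular: "(\<lambda>n. (1 / real n) * (\<Sum>i<n. (row_sum (A n) n i - avg_row_sum (A n) n)\<^sup>2)) \<longlonglongrightarrow> 0"
    and beta: "\<beta> > 0"
    and B: "B \<noteq> 0"
    and eps: "\<epsilon> > 0"
  shows "(\<lambda>n. ising_prob (A n) n \<beta> B (\<lambda>x. \<bar>T_stat (A n) n x\<bar> > \<epsilon>)) \<longlonglongrightarrow> 0"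
proof -
  obtain \<gamma> where \<gamma>: "\<And>n i. i < n \<Longrightarrow> row_sum (A n) n i \<le> \<gamma>"
    using C1 by blast
  let ?b = "\<bar>B\<bar>"
  define \<eta> where "\<eta> n = (1 / real n) * (\<Sum>i<n. \<Sum>j<n. (A n i j)\<^sup>2)" for n
  define \<rho> where "\<rho> n = (1 / real n) * (\<Sum>i<n. (row_sum (A n) n i - avg_row_sum (A n) n)\<^sup>2)" for n
  define bound where "bound \<delta> n = \<gamma> * sqrt (2 * \<eta> n / \<delta>) + 9 * \<gamma> / tanh ?b *
      (2 * sqrt (\<rho> n) + \<gamma> * (\<beta> * sqrt (\<gamma> * sqrt (2 * \<eta> n / \<delta>)) + \<delta>))" for \<delta> n
  \<comment> \<open>What survives of \<open>bound \<delta> n\<close> as \<open>n\<close> grows is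
    \<open>c * \<delta>\<close>.\<close>
  define c where "c = 9 * \<gamma> / tanh ?b * \<gamma>"
  have prob_le: "ising_prob (A n) n \<beta> B (\<lambda>x. \<bar>T_stat (A n) n x\<bar> > \<epsilon>) \<le> bound \<delta> n / \<epsilon>"
    if \<delta>: "0 < \<delta>" "\<delta> < ?b" and n: "0 < n" for \<delta> n
  proof -
    interpret ferromagnet "A n" n \<beta> \<gamma>
      by unfold_locales (use symm nonneg diag \<gamma> beta n in auto)
    have "ising_prob (A n) n \<beta> B (\<lambda>x. \<bar>T_stat (A n) n x\<bar> > \<epsilon>) \<le> E B (T_stat (A n) n) / \<epsilon>"
      using ising_prob_markov[OF eps, of n "T_stat (A n) n"] by (simp add: T_stat_nonneg)
    \<comment> \<open>The spin flip reduces a negative field to its absolute value.\<close>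
    also have "E B (T_stat (A n) n) = E ?b (T_stat (A n) n)"
      using expect_flip_all[of "A n" n \<beta> ?b "T_stat (A n) n"] by (auto simp: T_stat_flip_all abs_if)
    also have "\<dots> / \<epsilon> \<le> bound \<delta> n / \<epsilon>"
      using expect_T_stat_le[OF \<delta>] eps unfolding bound_def \<eta>_def \<rho>_def
      by (intro divide_right_mono) auto
    finally show ?thesis .
  qed
  have lim: "bound \<delta> \<longlonglongrightarrow> c * \<delta>" if "0 < \<delta>" for \<delta>
  proof -
    have "bound \<delta> \<longlonglongrightarrow> \<gamma> * sqrt (2 * 0 / \<delta>) + 9 * \<gamma> / tanh ?b *
      (2 * sqrt 0 + \<gamma> * (\<beta> * sqrt (\<gamma> * sqrt (2 * 0 / \<delta>)) + \<delta>))"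
      unfolding bound_def using mean_field regular that B
      by (intro tendsto_intros) (auto simp: \<eta>_def[abs_def] \<rho>_def[abs_def])
    then show ?thesis by (simp add: c_def mult.assoc)
  qed
  show ?thesis
  proof (rule tendstoI)
    fix e :: real assume e: "0 < e"
    \<comment> \<open>The width \<open>\<delta>\<close> is fixed from \<open>e\<close> first, and
      only then does \<open>n\<close> tend to infinity.\<close>
    have "((\<lambda>\<delta>. c * \<delta> / \<epsilon>) \<longlongrightarrow> c * 0 / \<epsilon>) (at_right 0)"
      using eps by (intro tendsto_intros) auto
    then have "\<forall>\<^sub>F \<delta> in at_right 0. c * \<delta> / \<epsilon> < e"
      using e by (intro order_tendstoD(2)) auto
    moreover have "\<forall>\<^sub>F \<delta> in at_right 0. \<delta> < ?b" "\<forall>\<^sub>F \<delta> in at_right 0. (0::real) < \<delta>"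
      using B eventually_at_right_less[of "0::real"] eventually_at_right_real[of 0 ?b]
      by (auto elim: eventually_mono)
    ultimately have "\<forall>\<^sub>F \<delta> in at_right 0. c * \<delta> / \<epsilon> < e \<and> \<delta> < ?b \<and> 0 < \<delta>"
      by eventually_elim auto
    then obtain \<delta> where \<delta>: "c * \<delta> / \<epsilon> < e" "\<delta> < ?b" "0 < \<delta>"
      using eventually_happens'[OF trivial_limit_at_right_real] by blast
    have "(\<lambda>n. bound \<delta> n / \<epsilon>) \<longlonglongrightarrow> c * \<delta> / \<epsilon>"
      using eps by (intro tendsto_intros lim \<delta>(3)) auto
    then have "\<forall>\<^sub>F n in sequentially. bound \<delta> n / \<epsilon> < e"
      by (rule order_tendstoD(2)) (rule \<delta>(1))
    then show "\<forall>\<^sub>F n in sequentially.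
        dist (ising_prob (A n) n \<beta> B (\<lambda>x. \<bar>T_stat (A n) n x\<bar> > \<epsilon>)) 0 < e"
      using eventually_gt_at_top[of 0]
    proof eventually_elim
      case (elim n)
      then show ?case
        using prob_le[OF \<delta>(3,2), of n] ising_prob_nonneg[of "A n" n \<beta> B] by simp
    qed
  qed
qed

end
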